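(* Let $\ell \geq 1$ be an integer and let $N(\ell) = \min\{n \geq 0 : L(n) = \ell\}$ be the minimum number of stones in a winning Tchoukaillon board of length $\ell$. Define integers $g_\ell = \ell$ and, for $i = \ell-1, \ell-2, \ldots, 1$, $g_i = i \left\lceil g_{i+1}/i \right\rceil$ (the least multiple of $i$ that is $\geq g_{i+1}$). Then $N(\ell) = g_1$; that is, \[ N(\ell) = \tfrac{2}{1}\left\lceil \tfrac{3}{2} \left\lceil \cdots \left\lceil \tfrac{\ell-1}{\ell-2} \left\lceil \tfrac{\ell}{\ell-1} \right\rceil \right\rceil \cdots \right\rceil \right\rceil . \]
   Context: Tchoukaillon boards. For each $n \geq 0$ define a sequence $b(n) = (b_1(n), b_2(n), \ldots)$ of nonnegative integers recursively: $b(0)$ is the all-zero sequence; given $b(n)$, let $p(n) = \min\{j \geq 1 : b_j(n) = 0\}$ and set $b_i(n+1) = b_i(n)$ if $i > p(n)$, $b_i(n+1) = i$ if $i = p(n)$, and $b_i(n+1) = b_i(n) - 1$ if $i < p(n)$. $b(n)$ is the unique winning Tchoukaillon board with $n$ stones. Its length is $L(n) = \min\{i \geq 0 : b_j(n) = 0 \text{ for all } j > i\}$. (For example $N(\ell)$ begins $1, 2, 4, 6, 10, 12, 18, \ldots$ for $\ell = 1, 2, 3, \ldots$.) *)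

theory Defs
  imports Complex_Main
begin

text \<open>
  A board is a sequence \<open>b\<^sub>1, b\<^sub>2, \<dots>\<close> of natural numbers, encoded as a function on \<^typ>\<open>nat\<close>.
  Positions start at 1; the unused entry at index 0 is always 0.
  The natural-number subtraction does not truncate at any position \<open>1 \<le> i < p\<close>,
  since those entries are positive by minimality of \<open>p\<close>.
\<close>

definition first_empty :: "(nat \<Rightarrow> nat) \<Rightarrow> nat" where
  "first_empty b = (LEAST j. j \<ge> 1 \<and> b j = 0)"

definition next_board :: "(nat \<Rightarrow> nat) \<Rightarrow> nat \<Rightarrow> nat" where
  "next_board b i =
     (let p = first_empty b in if i > p then b i else if i = p then i else b i - 1)"

primrec board :: "nat \<Rightarrow> nat \<Rightarrow> nat" where
  "board 0 = (\<lambda>i. 0)"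
| "board (Suc n) = next_board (board n)"

definition board_length :: "nat \<Rightarrow> nat" where
  "board_length n = (LEAST i. \<forall>j>i. board n j = 0)"

definition min_stones :: "nat \<Rightarrow> nat" where
  "min_stones l = (LEAST n. board_length n = l)"

text \<open>
  The sequence \<open>g\<^sub>\<ell> = \<ell>\<close>, \<open>g\<^sub>i = i \<lceil>g\<^sub>i\<^sub>+\<^sub>1 / i\<rceil>\<close>, by recursion downwards from \<open>i = \<ell>\<close>.
  Only the values at \<open>1 \<le> i \<le> \<ell>\<close> are meaningful.
\<close>

function round_up_seq :: "nat \<Rightarrow> nat \<Rightarrow> int" where
  "round_up_seq l i =
     (if i < l then int i * \<lceil>real_of_int (round_up_seq l (i + 1)) / real i\<rceil> else int l)"
  by auto
termination by (relation "measure (\<lambda>(l, i). l - i)") auto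

declare round_up_seq.simps [simp del]

text \<open>
  \<open>nested_ceiling l i\<close> is the tail of the nested expression starting with the factor \<open>(i+1)/i\<close>:
  \[ \frac{i+1}{i} \lceil \frac{i+2}{i+1} \lceil \cdots \lceil \frac{\ell}{\ell-1} \rceil \cdots \rceil \rceil . \]
  The expression without any factor (\<open>i = \<ell>\<close>) is 1; in particular \<open>nested_ceiling 1 1 = 1\<close>,
  and the innermost factor is \<open>\<ell>/(\<ell>-1) \<cdot> \<lceil>1\<rceil>\<close>.
\<close>

function nested_ceiling :: "nat \<Rightarrow> nat \<Rightarrow> real" where
  "nested_ceiling l i =
     (if i < l then real (i + 1) / real i * real_of_int \<lceil>nested_ceiling l (i + 1)\<rceil> else 1)"
  by auto
termination by (relation "measure (\<lambda>(l, i). l - i)") auto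

declare nested_ceiling.simps [simp del]

text \<open>The minima in the definitions above are taken over nonempty sets.\<close>

lemma board_bounds: "board n i \<le> i" "i > n \<Longrightarrow> board n i = 0"
proof -
  have "(\<forall>i. board n i \<le> i) \<and> (\<forall>i>n. board n i = 0)"
  proof (induction n)
    case (Suc n)
    have "first_empty (board n) \<le> Suc n"
      unfolding first_empty_def using Suc by (intro Least_le) auto
    then show ?case
      using Suc by (auto simp: next_board_def Let_def intro: le_trans[OF diff_le_self])
  qed simp
  then show "board n i \<le> i" "i > n \<Longrightarrow> board n i = 0" by auto
qed

lemma first_empty_exists: "\<exists>j. j \<ge> 1 \<and> board n j = 0"
  using board_bounds(2)[of n "Suc n"] by auto

lemma first_empty_board:
  shows "first_empty (board n) \<ge> 1" "board n (first_empty (board n)) = 0"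
    and "1 \<le> i \<Longrightarrow> i < first_empty (board n) \<Longrightarrow> board n i > 0"
  using LeastI_ex[OF first_empty_exists[of n]] not_less_Least[of i "\<lambda>j. j \<ge> 1 \<and> board n j = 0"]
  unfolding first_empty_def by auto

lemma board_length_exists: "\<exists>i. \<forall>j>i. board n j = 0"
  using board_bounds(2) by blast

lemma board_beyond_length: "j > board_length n \<Longrightarrow> board n j = 0"
  using LeastI_ex[OF board_length_exists[of n]] unfolding board_length_def by blast

lemma board_length_le: "(\<And>j. j > i \<Longrightarrow> board n j = 0) \<Longrightarrow> board_length n \<le> i"
  unfolding board_length_def by (rule Least_le) blast

lemma board_length_Suc_le: "board_length (Suc n) \<le> Suc (board_length n)"
proof (rule board_length_le)
  fix j assume j: "j > Suc (board_length n)"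
  have "first_empty (board n) \<le> Suc (board_length n)"
    unfolding first_empty_def by (intro Least_le) (auto intro: board_beyond_length)
  with j show "board (Suc n) j = 0"
    by (simp add: next_board_def Let_def board_beyond_length)
qed

text \<open>Every move adds one stone, so \<open>b(n)\<close> has \<open>n\<close> stones.\<close>

lemma board_sum: "m \<ge> n \<Longrightarrow> (\<Sum>i=1..m. board n i) = n"
proof (induction n)
  case (Suc n)
  define p where "p = first_empty (board n)"
  have p: "1 \<le> p" "p \<le> m" "board n p = 0" "\<And>i. 1 \<le> i \<Longrightarrow> i < p \<Longrightarrow> board n i > 0"
  proof -
    have "p \<le> Suc n"
      unfolding p_def first_empty_def by (intro Least_le) (simp add: board_bounds(2))
    then show "p \<le> m" using Suc.prems by simp
  qed (simp_all only: p_def first_empty_board)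
  have split: "(\<Sum>i=1..m. f i) = (\<Sum>i\<in>{1..<p}. f i) + f p + (\<Sum>i\<in>{p<..m}. f i)"
    for f :: "nat \<Rightarrow> nat"
  proof -
    have "{1..m} = insert p {1..<p} \<union> {p<..m}" using p by auto
    then show ?thesis by (subst \<open>{1..m} = _\<close>, subst sum.union_disjoint) auto
  qed
  have "(\<Sum>i\<in>{1..<p}. board n i) = (\<Sum>i\<in>{1..<p}. (board n i - 1) + 1)"
    using p(4) by (intro sum.cong) (auto simp: Suc_le_eq)
  also have "\<dots> = (\<Sum>i\<in>{1..<p}. board n i - 1) + (p - 1)"
    by (subst sum.distrib) simp
  finally have low: "(\<Sum>i\<in>{1..<p}. board n i) = (\<Sum>i\<in>{1..<p}. board n i - 1) + (p - 1)" .
  have "(\<Sum>i=1..m. board (Suc n) i)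
      = (\<Sum>i\<in>{1..<p}. board n i - 1) + p + (\<Sum>i\<in>{p<..m}. board n i)"
    unfolding split[of "board (Suc n)"]
    by (intro arg_cong2[where f = "(+)"] sum.cong) (auto simp: next_board_def p_def[symmetric])
  also have "\<dots> = Suc (\<Sum>i=1..m. board n i)"
    unfolding split[of "board n"] using low p(1,3) by simp
  also have "\<dots> = Suc n" using Suc by simp
  finally show ?case .
qed simp

lemma stones_le_length: "n \<le> board_length n * board_length n"
proof -
  let ?L = "board_length n"
  have "n = (\<Sum>i=1..max n ?L. board n i)" by (rule board_sum[symmetric]) simp
  also have "\<dots> = (\<Sum>i=1..?L. board n i)"
    by (intro sum.mono_neutral_right) (auto intro: board_beyond_length)
  also have "\<dots> \<le> (\<Sum>i=1..?L. ?L)"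
    by (intro sum_mono) (auto intro: le_trans[OF board_bounds(1)])
  finally show ?thesis by simp
qed

lemma min_stones_exists: "\<exists>n. board_length n = l"
proof -
  have "\<exists>n. board_length n \<ge> l"
  proof (rule ccontr)
    assume "\<not> ?thesis"
    then have "board_length (l * l + 1) \<le> l" by (meson nat_le_linear)
    then show False
      using stones_le_length[of "l * l + 1"] mult_le_mono[of "board_length (l * l + 1)" l _ l]
      by fastforce
  qed
  then obtain n where n: "board_length n \<ge> l" by blast
  show ?thesis using n
  proof (induction n)
    case 0
    have "board_length 0 \<le> 0" by (rule board_length_le) simp
    with 0 show ?case by auto
  next
    case (Suc n)
    show ?case
    proof (cases "board_length n \<ge> l")
      case False
      with Suc.prems board_length_Suc_le[of n] have "board_length (Suc n) = l" by linarith
      then show ?thesis by blast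
    qed (use Suc.IH in blast)
  qed
qed

end

theory Submission imports Defs begin

text \<open>
  Let \<open>T\<^sub>i(n)\<close> be the number of the first \<open>n\<close> moves whose first empty position is at least \<open>i\<close>.
  Position \<open>i\<close> changes only at these moves and cycles through \<open>0, i, i - 1, \<dots>, 1\<close>, so
  \<open>T\<^sub>i\<^sub>+\<^sub>1(n) = \<lfloor>i T\<^sub>i(n) / (i + 1)\<rfloor>\<close> with remainder \<open>b\<^sub>i(n)\<close>. The length reaches \<open>\<ell>\<close> when \<open>T\<^sub>\<ell>\<close>
  becomes positive, and inverting the floors from \<open>i = \<ell>\<close> down to \<open>1\<close> turns the condition
  \<open>T\<^sub>\<ell>(n) \<ge> 1\<close> into \<open>i T\<^sub>i(n) \<ge> g\<^sub>i\<close>, where \<open>T\<^sub>1(n) = n\<close>.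
\<close>

definition moves_from :: "nat \<Rightarrow> nat \<Rightarrow> nat" where
  "moves_from i n = card {k. k < n \<and> i \<le> first_empty (board k)}"

lemma moves_from_0 [simp]: "moves_from i 0 = 0"
  by (simp add: moves_from_def)

lemma moves_from_Suc:
  "moves_from i (Suc n) = moves_from i n + (if i \<le> first_empty (board n) then 1 else 0)"
proof -
  have "{k. k < Suc n \<and> i \<le> first_empty (board k)} = {k. k < n \<and> i \<le> first_empty (board k)} \<union>
     (if i \<le> first_empty (board n) then {n} else {})"
    by (auto simp: less_Suc_eq)
  then show ?thesis by (simp add: moves_from_def)
qed

lemma moves_from_1 [simp]: "moves_from (Suc 0) n = n"
  by (induction n) (use first_empty_board(1) in \<open>auto simp: moves_from_Suc\<close>)

text \<open>A move beyond \<open>i\<close> raises both counts and takes one stone from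
  \<open>i\<close>, changing either side by \<open>i\<close>. A move at \<open>i\<close> raises only
  \<open>moves_from i\<close> and fills the empty position with \<open>i\<close> stones. A move
  below \<open>i\<close> changes nothing.\<close>

lemma moves_from_balance:
  assumes "1 \<le> i"
  shows "Suc i * moves_from (Suc i) n + board n i = i * moves_from i n"
proof (induction n)
  case (Suc n)
  define p where "p = first_empty (board n)"
  have empty: "board n p = 0" and pos: "i < p \<Longrightarrow> board n i > 0"
    using assms by (simp_all add: p_def first_empty_board)
  consider "i < p" | "i = p" | "p < i" by linarith
  then show ?case
    by cases (use Suc empty pos in
        \<open>auto simp: moves_from_Suc next_board_def Let_def p_def[symmetric]\<close>)
qed simp

lemma board_eq_0_if_no_moves_from:
  assumes "moves_from l n = 0" "1 \<le> l" "l \<le> j"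
  shows "board n j = 0"
proof -
  have "moves_from j n \<le> moves_from l n"
    unfolding moves_from_def using assms(3) by (intro card_mono) auto
  then show ?thesis using moves_from_balance[of j n] assms by simp
qed

text \<open>Until the first move at or beyond \<open>l\<close>, all positions from \<open>l\<close>
  on are empty. Hence that move is played exactly at \<open>l\<close> and makes the length
  \<open>l\<close>, while all earlier lengths are smaller.\<close>

lemma min_stones_eq_Least_moves_from:
  assumes "1 \<le> l" and ex: "moves_from l m > 0"
  shows "min_stones l = (LEAST n. moves_from l n > 0)"
proof -
  define N where "N = (LEAST n. moves_from l n > 0)"
  have pos: "moves_from l N > 0" unfolding N_def using ex by (rule LeastI)
  have before: "moves_from l n = 0" if "n < N" for n
    using not_less_Least[of n "\<lambda>n. moves_from l n > 0"] that unfolding N_def by blast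
  obtain k where k: "N = Suc k" using pos by (cases N) auto
  have zero: "board k j = 0" if "l \<le> j" for j
    using board_eq_0_if_no_moves_from[OF before] assms(1) that k by blast
  have "l \<le> first_empty (board k)"
    using pos before[of k] by (simp add: k moves_from_Suc split: if_splits)
  moreover have "first_empty (board k) \<le> l"
    unfolding first_empty_def using assms zero by (intro Least_le) auto
  ultimately have p: "first_empty (board k) = l" by simp
  have "board_length N = l"
  proof (rule antisym)
    show "board_length N \<le> l"
      by (rule board_length_le) (simp add: k next_board_def p zero)
    have "board N l \<noteq> 0" using assms by (simp add: k next_board_def p)
    then show "l \<le> board_length N" using board_beyond_length[of N l] by (cases "board_length N < l") auto
  qed
  moreover have "N \<le> n" if "board_length n = l" for n
  proof (rule ccontr)
    assume "\<not> N \<le> n"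
    then have "board_length n \<le> l - 1"
      using board_eq_0_if_no_moves_from[OF before] assms(1) by (intro board_length_le) auto
    then show False using that assms(1) by simp
  qed
  ultimately show ?thesis
    unfolding min_stones_def N_def[symmetric] by (rule Least_equality)
qed

text \<open>Besides linking the two formulas, this exhibits the divisibility by \<open>i\<close>
  that the floor inversion relies on.\<close>

lemma round_up_seq_eq_nested_ceiling:
  assumes "1 \<le> i" "i \<le> l"
  shows "round_up_seq l i = int i * \<lceil>nested_ceiling l i\<rceil>"
  using assms(2,1)
proof (induction rule: inc_induct)
  case base
  show ?case by (simp add: round_up_seq.simps nested_ceiling.simps)
next
  case (step i)
  then have "nested_ceiling l i = real_of_int (round_up_seq l (Suc i)) / real i"
    by (subst nested_ceiling.simps) simp
  with step show ?case by (subst round_up_seq.simps) simp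
qed

lemma moves_from_pos_iff:
  assumes "1 \<le> i" "i \<le> l"
  shows "moves_from l n > 0 \<longleftrightarrow> round_up_seq l i \<le> int (i * moves_from i n)"
  using assms(2,1)
proof (induction rule: inc_induct)
  case base
  then show ?case by (simp add: round_up_seq.simps Suc_le_eq)
next
  case (step i)
  define c where "c = \<lceil>nested_ceiling l (Suc i)\<rceil>"
  have g: "round_up_seq l (Suc i) = int (Suc i) * c"
    unfolding c_def using step by (intro round_up_seq_eq_nested_ceiling) auto
  have "moves_from l n > 0 \<longleftrightarrow> c \<le> int (moves_from (Suc i) n)"
    using step.IH by (simp only: g of_nat_mult mult_le_cancel_left_pos of_nat_0_less_iff zero_less_Suc)
  \<comment> \<open>The right-hand count exceeds \<open>Suc i * moves_from (Suc i) n\<close> by the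
    remainder \<open>board n i\<close>, which is less than \<open>Suc i\<close>. Such a remainder
    cannot carry it up to a further multiple of \<open>Suc i\<close>, and the bound is such a
    multiple.\<close>
  also have "\<dots> \<longleftrightarrow> round_up_seq l (Suc i) \<le> int (i * moves_from i n)"
  proof -
    have balance: "int (Suc i) * int (moves_from (Suc i) n) + int (board n i) =
        int (i * moves_from i n)"
      using moves_from_balance[OF step.prems, of n] by (metis of_nat_add of_nat_mult)
    have small: "int (board n i) < int (Suc i)"
      using board_bounds(1)[of n i] by simp
    show ?thesis
    proof (cases "c \<le> int (moves_from (Suc i) n)")
      case True
      then have "int (Suc i) * c \<le> int (Suc i) * int (moves_from (Suc i) n)"
        by (intro mult_left_mono) auto
      then have "round_up_seq l (Suc i) \<le> int (i * moves_from i n)"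
        using balance unfolding g by linarith
      with True show ?thesis by blast
    next
      case False
      then have "int (Suc i) * (int (moves_from (Suc i) n) + 1) \<le> int (Suc i) * c"
        by (intro mult_left_mono) auto
      then have "\<not> round_up_seq l (Suc i) \<le> int (i * moves_from i n)"
        using balance small unfolding g distrib_left mult_1_right by linarith
      with False show ?thesis by blast
    qed
  qed
  also have "\<dots> \<longleftrightarrow> real_of_int (round_up_seq l (Suc i)) / real i \<le> real (moves_from i n)"
  proof -
    have "round_up_seq l (Suc i) \<le> int (i * moves_from i n) \<longleftrightarrow>
        real_of_int (round_up_seq l (Suc i)) \<le> real_of_int (int (i * moves_from i n))"
      by (simp only: of_int_le_iff)
    then show ?thesis using step.prems by (simp add: divide_le_eq mult.commute)
  qed
  also have "\<dots> \<longleftrightarrow> \<lceil>real_of_int (round_up_seq l (Suc i)) / real i\<rceil> \<le> int (moves_from i n)"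
    by (simp add: ceiling_le_iff)
  also have "\<dots> \<longleftrightarrow> round_up_seq l i \<le> int (i * moves_from i n)"
    using step by (subst round_up_seq.simps) simp
  finally show ?case .
qed

theorem theorem3p5:
  fixes l :: nat
  assumes "l \<ge> 1"
  shows "int (min_stones l) = round_up_seq l 1 \<and>
         real (min_stones l) = nested_ceiling l 1"
proof -
  have g: "round_up_seq l 1 = \<lceil>nested_ceiling l 1\<rceil>"
    using round_up_seq_eq_nested_ceiling[of 1 l] assms by simp
  have iff: "moves_from l n > 0 \<longleftrightarrow> round_up_seq l 1 \<le> int n" for n
    using moves_from_pos_iff[of 1 l n] assms by simp
  \<comment> \<open>No move has been played at \<open>n = 0\<close>, so the bound fails
    there.\<close>
  have nonneg: "round_up_seq l 1 \<ge> 0"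
    using iff[of 0] by simp
  have "min_stones l = (LEAST n. round_up_seq l 1 \<le> int n)"
    using min_stones_eq_Least_moves_from[OF assms, of "nat (round_up_seq l 1)"] by (simp add: iff)
  also have "\<dots> = nat (round_up_seq l 1)"
    by (rule Least_equality) auto
  finally have N: "int (min_stones l) = round_up_seq l 1"
    using nonneg by simp
  \<comment> \<open>The outermost factor is \<open>2/1\<close>, or the expression is just 1, so the
    value is already an integer.\<close>
  have "nested_ceiling l 1 = real_of_int \<lceil>nested_ceiling l 1\<rceil>"
    by (subst (1 2) nested_ceiling.simps) simp
  then have "real (min_stones l) = nested_ceiling l 1"
    using g N by (metis of_int_of_nat_eq)
  with N show ?thesis by simp
qed

end
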